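(* Let $A$ be a commutative ring with unit and $\mathcal{A}=1+XA[[X]]$. The set $(\mathcal{A},\,\cdot\,,\star)$, with multiplication of power series as additive structure and the eñe product $\star$ as multiplicative structure, is a commutative ring with zero element $1\in\mathcal{A}$ and unity $1-X\in\mathcal{A}$. More precisely: (i) $(\mathcal{A},\cdot)$ is an abelian group; (ii) for $f,g,h\in\mathcal{A}$, $(f\cdot g)\star h=(f\star h)\cdot(g\star h)$; (iii) for $f,g,h\in\mathcal{A}$, $(f\star g)\star h=f\star(g\star h)$; (iv) for $f,g\in\mathcal{A}$, $f\star g=g\star f$; (v) for $f\in\mathcal{A}$, $f\star(1-X)=(1-X)\star f=f$.
   Context: For $n\ge1$, let $Q_n\in\mathbb{Z}[X_1,\dots,X_n,Y_1,\dots,Y_n]$ be the unique polynomial such that in $\mathbb{Z}[x_1,\dots,x_n,y_1,\dots,y_n]$ the $n$-th elementary symmetric polynomial of the $n^2$ products $x_iy_j$ equals $Q_n(e_1(x),\dots,e_n(x),e_1(y),\dots,e_n(y))$, where $e_k$ are the elementary symmetric polynomials. For $f=1+\sum_{n\ge1}a_nX^n$ and $g=1+\sum_{n\ge1}b_nX^n$ in $\mathcal{A}$, the eñe product is $f\star g=1+\sum_{n\ge1}c_nX^n$ with $c_n=(-1)^nQ_n(a_1,\dots,a_n,b_1,\dots,b_n)$. *)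

theory Defs
  imports
    "HOL-Library.Poly_Mapping"
    "HOL-Computational_Algebra.Formal_Power_Series"
    "HOL-Algebra.Ring"
begin

text \<open>
  The coefficient ring \<open>A\<close> is a type of sort \<open>{comm_ring, comm_monoid_mult}\<close>, i.e. a commutative
  ring with unit. The class \<open>comm_ring_1\<close> would in addition demand \<open>0 \<noteq> 1\<close> and so exclude the zero
  ring; every type of class \<open>comm_ring_1\<close> has the sort used here. As \<open>of_int\<close> is not available
  without \<open>0 \<noteq> 1\<close>, the integer multiples \<open>k a\<close> are written out.
\<close>

definition int_scale :: "int \<Rightarrow> 'a::ab_group_add \<Rightarrow> 'a" where
  "int_scale k a = (\<Sum>_<nat k. a) - (\<Sum>_<nat (- k). a)"

lemma int_scale_of_int:
  fixes a :: "'a::comm_ring_1"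
  shows "int_scale k a = of_int k * a"
proof (cases "k \<ge> 0")
  case True
  then show ?thesis by (simp add: int_scale_def)
next
  case False
  then have "of_nat (nat (- k)) = (of_int (- k) :: 'a)"
    by simp
  with False show ?thesis
    by (simp add: int_scale_def)
qed

text \<open>
  Polynomials over \<open>\<int>\<close> in variables indexed by \<open>'v\<close>: a monomial is a finitely supported exponent
  function, and a polynomial is a finitely supported function from monomials to \<open>int\<close>, with the
  convolution product of \<^theory>\<open>HOL-Library.Poly_Mapping\<close>.
\<close>

type_synonym 'v int_mpoly = "('v \<Rightarrow>\<^sub>0 nat) \<Rightarrow>\<^sub>0 int"

definition mpoly_var :: "'v \<Rightarrow> 'v int_mpoly" where
  "mpoly_var v = Poly_Mapping.single (Poly_Mapping.single v 1) 1"

definition mpoly_vars :: "'v int_mpoly \<Rightarrow> 'v set" where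
  "mpoly_vars p = (\<Union>m\<in>Poly_Mapping.keys p. Poly_Mapping.keys m)"

definition mpoly_eval ::
  "('v \<Rightarrow> 'a::{comm_ring, comm_monoid_mult}) \<Rightarrow> 'v int_mpoly \<Rightarrow> 'a" where
  "mpoly_eval s p = (\<Sum>m\<in>Poly_Mapping.keys p. int_scale (Poly_Mapping.lookup p m)
     (\<Prod>v\<in>Poly_Mapping.keys m. s v ^ Poly_Mapping.lookup m v))"

definition elem_sym :: "nat \<Rightarrow> 'i set \<Rightarrow> ('i \<Rightarrow> 'r::comm_semiring_1) \<Rightarrow> 'r" where
  "elem_sym k I x = (\<Sum>S | S \<subseteq> I \<and> card S = k. \<Prod>i\<in>S. x i)"

text \<open>
  In the polynomial \<open>Q\<^sub>n\<close>, the variables \<open>X\<^sub>k\<close> and \<open>Y\<^sub>k\<close> are indexed by \<open>Inl k\<close> and \<open>Inr k\<close>, and so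
  are \<open>x\<^sub>i\<close> and \<open>y\<^sub>j\<close> in the polynomial ring in which the defining identity is stated.
\<close>

definition ene_poly :: "nat \<Rightarrow> (nat + nat) int_mpoly" where
  "ene_poly n = (THE Q.
     mpoly_vars Q \<subseteq> Inl ` {1..n} \<union> Inr ` {1..n} \<and>
     elem_sym n ({1..n} \<times> {1..n}) (\<lambda>(i, j). mpoly_var (Inl i) * mpoly_var (Inr j)) =
     mpoly_eval
       (case_sum (\<lambda>k. elem_sym k {1..n} (\<lambda>i. mpoly_var (Inl i :: nat + nat)))
                 (\<lambda>k. elem_sym k {1..n} (\<lambda>j. mpoly_var (Inr j :: nat + nat)))) Q)"

definition one_plus_X_fps :: "'a::{comm_ring, comm_monoid_mult} fps set" where
  "one_plus_X_fps = {f. fps_nth f 0 = 1}"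

definition ene_prod ::
  "'a::{comm_ring, comm_monoid_mult} fps \<Rightarrow> 'a fps \<Rightarrow> 'a fps"  (infixl \<open>\<star>\<close> 70) where
  "f \<star> g = Abs_fps (\<lambda>n. if n = 0 then 1
     else (- 1) ^ n * mpoly_eval (case_sum (fps_nth f) (fps_nth g)) (ene_poly n))"

definition ene_ring :: "'a::{comm_ring, comm_monoid_mult} fps ring" where
  "ene_ring = \<lparr>carrier = one_plus_X_fps, monoid.mult = (\<star>), one = 1 - fps_X,
               zero = 1, add = (*)\<rparr>"

end

theory Submission
  imports
    Defs
    "HOL-Computational_Algebra.Fundamental_Theorem_Algebra"
    "HOL-Computational_Algebra.Polynomial_FPS"
begin

text \<open>
  Each law is a family of identities between integer polynomials in the coefficients of the series
  involved, so it suffices to check it over \<open>\<complex>\<close>. There every series agrees to any given order with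
  a product \<open>\<Prod>(1 - x\<^sub>i X)\<close>, and \<open>\<Prod>(1 - x\<^sub>i X) \<star> \<Prod>(1 - y\<^sub>j X) = \<Prod>(1 - x\<^sub>i y\<^sub>j X)\<close>. Hence
  \<open>f \<mapsto> - X f' / f\<close>, which collects the power sums of the \<open>x\<^sub>i\<close> and is injective, turns the product of
  series into the sum and \<open>\<star>\<close> into the coefficientwise product, for which the laws are evident.
\<close>

section \<open>Evaluation of integer polynomials\<close>

text \<open>The polynomials \<open>ene_poly n\<close> are given by a definite description, so
  nothing can be computed from them until existence and uniqueness are settled. Existence needs no
  theory of polynomials symmetric in two families: grouping the factors \<open>1 + x_i y_j T\<close>
  by \<open>i\<close> yields the product of the \<open>g(x_i T)\<close>, where \<open>g\<close> is
  the product of the \<open>1 + y_j T\<close>. This is symmetric in the \<open>x_i\<close> alone,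
  and the coefficients of \<open>g\<close> may stay free variables. The complex field supplies three
  things: enough points to separate integer polynomials, roots realizing any prescribed elementary
  symmetric functions, and division by \<open>n\<close> on the way back from power sums to
  coefficients. A further obstacle is that the defining identity of \<open>ene_poly m\<close>
  concerns families of exactly \<open>m\<close> members, whereas agreement to order \<open>n\<close>
  is achieved with \<open>n\<close> roots. So for \<open>m < n\<close> the formula for products of
  roots is not immediate from the definition. Elementary symmetric functions belong to factors
  \<open>1 + x_i X\<close>; the numbers whose power sums appear in \<open>ghost\<close> are
  therefore the \<open>- x_i\<close>.\<close>

lemma int_scale_0_left [simp]: "int_scale 0 a = 0"
  by (simp add: int_scale_def)

lemma int_scale_1_left [simp]: "int_scale 1 a = a"
  by (simp add: int_scale_def)

lemma int_scale_plus_one: "int_scale (k + 1) a = int_scale k a + a"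
proof (cases "k \<ge> 0")
  case True
  then show ?thesis
    by (simp add: int_scale_def nat_add_distrib)
next
  case False
  then have "nat (- k) = Suc (nat (- (k + 1)))"
    by simp
  with False show ?thesis
    by (simp add: int_scale_def)
qed

lemma int_scale_add: "int_scale (k + l) a = int_scale k a + int_scale l a"
proof (induction l rule: int_induct[where k = 0])
  case (step1 i)
  then show ?case
    using int_scale_plus_one[of "k + i" a] int_scale_plus_one[of i a] by (simp add: add.assoc)
next
  case (step2 i)
  then show ?case
    using int_scale_plus_one[of "k + (i - 1)" a] int_scale_plus_one[of "i - 1" a]
    by (simp add: algebra_simps)
qed simp

lemma int_scale_times: "int_scale (k * l) (a * b) = int_scale k a * int_scale l (b::'a::comm_ring)"
proof -
  have right: "int_scale k a * b = int_scale k (a * b)" for k and a b :: 'a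
    by (simp add: int_scale_def left_diff_distrib sum_distrib_right)
  have left: "a * int_scale k b = int_scale k (a * b)" for k and a b :: 'a
    by (simp add: int_scale_def right_diff_distrib sum_distrib_left)
  have "int_scale (k * l) c = int_scale k (int_scale l c)" for c :: 'a
  proof (induction k rule: int_induct[where k = 0])
    case (step1 i)
    then show ?case
      by (simp add: int_scale_plus_one distrib_right int_scale_add)
  next
    case (step2 i)
    then show ?case
      using int_scale_plus_one[of "i - 1" "int_scale l c"] int_scale_add[of "(i - 1) * l" l c]
      by (simp add: algebra_simps)
  qed simp
  note assoc = this
  show ?thesis
    by (simp only: assoc right) (simp only: left)
qed

definition monom_eval :: "('v \<Rightarrow> 'a::comm_monoid_mult) \<Rightarrow> ('v \<Rightarrow>\<^sub>0 nat) \<Rightarrow> 'a" where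
  "monom_eval s m = (\<Prod>v\<in>Poly_Mapping.keys m. s v ^ Poly_Mapping.lookup m v)"

lemma monom_eval_superset:
  assumes "finite V" "Poly_Mapping.keys m \<subseteq> V"
  shows "monom_eval s m = (\<Prod>v\<in>V. s v ^ Poly_Mapping.lookup m v)"
  unfolding monom_eval_def
  by (rule prod.mono_neutral_left) (use assms in \<open>auto simp: in_keys_iff\<close>)

lemma monom_eval_0 [simp]: "monom_eval s 0 = 1"
  by (simp add: monom_eval_def)

lemma monom_eval_add: "monom_eval s (m + n) = monom_eval s m * monom_eval s n"
proof -
  let ?V = "Poly_Mapping.keys m \<union> Poly_Mapping.keys n"
  have "Poly_Mapping.keys (m + n) \<subseteq> ?V"
    by (rule Poly_Mapping.keys_add)
  then show ?thesis
    by (simp add: monom_eval_superset[of ?V] lookup_add power_add prod.distrib)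
qed

lemma mpoly_eval_superset:
  assumes "finite K" "Poly_Mapping.keys p \<subseteq> K"
  shows "mpoly_eval s p = (\<Sum>m\<in>K. int_scale (Poly_Mapping.lookup p m) (monom_eval s m))"
  unfolding mpoly_eval_def monom_eval_def
  by (rule sum.mono_neutral_left) (use assms in \<open>auto simp: in_keys_iff\<close>)

lemma mpoly_eval_single: "mpoly_eval s (Poly_Mapping.single m c) = int_scale c (monom_eval s m)"
  by (subst mpoly_eval_superset[of "{m}"]) auto

lemma mpoly_eval_add: "mpoly_eval s (p + q) = mpoly_eval s p + mpoly_eval s q"
proof -
  let ?K = "Poly_Mapping.keys p \<union> Poly_Mapping.keys q"
  have "Poly_Mapping.keys (p + q) \<subseteq> ?K"
    by (rule Poly_Mapping.keys_add)
  then show ?thesis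
    by (simp add: mpoly_eval_superset[of ?K] lookup_add int_scale_add sum.distrib)
qed

lemma mpoly_eval_0: "mpoly_eval s 0 = 0"
  by (simp add: mpoly_eval_def)

lemma mpoly_eval_sum: "mpoly_eval s (sum f I) = (\<Sum>i\<in>I. mpoly_eval s (f i))"
  by (induction I rule: infinite_finite_induct) (simp_all add: mpoly_eval_0 mpoly_eval_add)

lemma int_mpoly_eq_sum_single:
  fixes p :: "'v int_mpoly"
  shows "p = (\<Sum>m\<in>Poly_Mapping.keys p. Poly_Mapping.single m (Poly_Mapping.lookup p m))"
  by (rule poly_mapping_eqI) (auto simp: lookup_sum lookup_single when_def in_keys_iff)

lemma mpoly_eval_mult: "mpoly_eval s (p * q) = mpoly_eval s p * mpoly_eval s q"
proof -
  have "p * q = (\<Sum>m\<in>Poly_Mapping.keys p. \<Sum>n\<in>Poly_Mapping.keys q.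
      Poly_Mapping.single (m + n) (Poly_Mapping.lookup p m * Poly_Mapping.lookup q n))"
    by (subst int_mpoly_eq_sum_single[of p], subst int_mpoly_eq_sum_single[of q])
      (simp add: sum_product mult_single)
  then show ?thesis
    by (simp add: mpoly_eval_sum mpoly_eval_single monom_eval_add int_scale_times sum_product)
      (simp add: mpoly_eval_def monom_eval_def sum_product)
qed

lemma mpoly_eval_1: "mpoly_eval s 1 = 1"
  using mpoly_eval_single[of s 0 1] by simp

lemma mpoly_eval_var [simp]: "mpoly_eval s (mpoly_var v) = s v"
  by (simp add: mpoly_var_def mpoly_eval_single monom_eval_def)

lemma mpoly_eval_cong:
  assumes "\<And>v. v \<in> mpoly_vars p \<Longrightarrow> s v = t v"
  shows "mpoly_eval s p = mpoly_eval t p"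
  unfolding mpoly_eval_def
  by (intro sum.cong refl arg_cong[where f = "int_scale _"] prod.cong arg_cong2[where f = power])
    (use assms in \<open>auto simp: mpoly_vars_def\<close>)

text \<open>Two maps share this interface: evaluation of integer polynomials, and evaluation of the
  coefficients of a one-variable polynomial followed by evaluation at a point. The weak sort keeps
  the zero ring among the possible targets.\<close>

locale unital_ring_hom =
  fixes h :: "'a::{comm_ring, comm_monoid_mult} \<Rightarrow> 'b::{comm_ring, comm_monoid_mult}"
  assumes add: "h (x + y) = h x + h y"
    and mult: "h (x * y) = h x * h y"
    and one: "h 1 = 1"
begin

lemma zero: "h 0 = 0"
  using add[of 0 0] by simp

lemma uminus: "h (- x) = - h x"
  using add[of x "- x"] by (simp add: zero minus_unique)

lemma diff: "h (x - y) = h x - h y"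
  using add[of x "- y"] by (simp add: uminus)

lemma sum: "h (sum f I) = (\<Sum>i\<in>I. h (f i))"
  by (induction I rule: infinite_finite_induct) (simp_all add: zero add)

lemma prod: "h (prod f I) = (\<Prod>i\<in>I. h (f i))"
  by (induction I rule: infinite_finite_induct) (simp_all add: one mult)

lemma power: "h (x ^ n) = h x ^ n"
  by (induction n) (simp_all add: one mult)

lemma int_scale: "h (int_scale k x) = int_scale k (h x)"
  by (simp add: int_scale_def diff sum)

lemma mpoly_eval: "h (mpoly_eval s p) = mpoly_eval (\<lambda>v. h (s v)) p"
  by (simp add: mpoly_eval_def sum int_scale prod power)

end

lemma unital_ring_hom_elem_sym:
  fixes h :: "'a::comm_ring_1 \<Rightarrow> 'b::comm_ring_1"
  assumes "unital_ring_hom h"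
  shows "h (elem_sym k I x) = elem_sym k I (\<lambda>i. h (x i))"
  by (simp add: elem_sym_def unital_ring_hom.sum[OF assms] unital_ring_hom.prod[OF assms])

lemma unital_ring_hom_mpoly_eval: "unital_ring_hom (mpoly_eval s)"
  by unfold_locales (rule mpoly_eval_add mpoly_eval_mult mpoly_eval_1)+

lemmas mpoly_eval_uminus = unital_ring_hom.uminus[OF unital_ring_hom_mpoly_eval]
  and mpoly_eval_diff = unital_ring_hom.diff[OF unital_ring_hom_mpoly_eval]
  and mpoly_eval_power = unital_ring_hom.power[OF unital_ring_hom_mpoly_eval]
  and mpoly_eval_mpoly_eval = unital_ring_hom.mpoly_eval[OF unital_ring_hom_mpoly_eval]
  and mpoly_eval_elem_sym = unital_ring_hom_elem_sym[OF unital_ring_hom_mpoly_eval]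

section \<open>Variables occurring in a polynomial\<close>

lemma mpoly_vars_add: "mpoly_vars (p + q) \<subseteq> mpoly_vars p \<union> mpoly_vars q"
  using Poly_Mapping.keys_add[of p q] by (fastforce simp: mpoly_vars_def)

lemma mpoly_vars_mult: "mpoly_vars (p * q) \<subseteq> mpoly_vars p \<union> mpoly_vars q"
proof
  fix v assume "v \<in> mpoly_vars (p * q)"
  then obtain m where m: "m \<in> Poly_Mapping.keys (p * q)" "v \<in> Poly_Mapping.keys m"
    by (auto simp: mpoly_vars_def)
  then obtain a b where ab: "a \<in> Poly_Mapping.keys p" "b \<in> Poly_Mapping.keys q" "m = a + b"
    using keys_mult[of p q] by blast
  then show "v \<in> mpoly_vars p \<union> mpoly_vars q"
    using m(2) Poly_Mapping.keys_add[of a b] by (fastforce simp: mpoly_vars_def)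
qed

lemma mpoly_vars_0 [simp]: "mpoly_vars 0 = {}"
  and mpoly_vars_1 [simp]: "mpoly_vars 1 = {}"
  and mpoly_vars_var [simp]: "mpoly_vars (mpoly_var v) = {v}"
  by (simp_all add: mpoly_vars_def mpoly_var_def)

lemma mpoly_vars_uminus [simp]: "mpoly_vars (- p) = mpoly_vars p"
  by (simp add: mpoly_vars_def)

lemma mpoly_vars_diff: "mpoly_vars (p - q) \<subseteq> mpoly_vars p \<union> mpoly_vars q"
  using mpoly_vars_add[of p "- q"] by simp

lemma finite_mpoly_vars: "finite (mpoly_vars p)"
  by (simp add: mpoly_vars_def)

lemma mpoly_vars_sum:
  assumes "\<And>i. i \<in> I \<Longrightarrow> mpoly_vars (f i) \<subseteq> V"
  shows "mpoly_vars (sum f I) \<subseteq> V"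
  using assms
proof (induction I rule: infinite_finite_induct)
  case (insert i I)
  then show ?case
    using mpoly_vars_add[of "f i" "sum f I"] by auto
qed simp_all

lemma mpoly_vars_prod:
  assumes "\<And>i. i \<in> I \<Longrightarrow> mpoly_vars (f i) \<subseteq> V"
  shows "mpoly_vars (prod f I) \<subseteq> V"
  using assms
proof (induction I rule: infinite_finite_induct)
  case (insert i I)
  then show ?case
    using mpoly_vars_mult[of "f i" "prod f I"] by auto
qed simp_all

lemma mpoly_vars_mpoly_eval:
  assumes "\<And>v. mpoly_vars (s v) \<subseteq> V"
  shows "mpoly_vars (mpoly_eval s p) \<subseteq> V"
proof -
  have pow: "mpoly_vars (s v ^ n) \<subseteq> V" for v n
    using mpoly_vars_prod[of "{..<n}" "\<lambda>_. s v" V] assms by simp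
  have scale: "mpoly_vars (int_scale k q) \<subseteq> V" if "mpoly_vars q \<subseteq> V" for k and q :: "'b int_mpoly"
  proof -
    have "mpoly_vars (\<Sum>_<n. q) \<subseteq> V" for n :: nat
      by (rule mpoly_vars_sum) (rule that)
    then show ?thesis
      unfolding int_scale_def by (intro order.trans[OF mpoly_vars_diff] Un_least)
  qed
  show ?thesis
    unfolding mpoly_eval_def by (intro mpoly_vars_sum scale mpoly_vars_prod pow)
qed

section \<open>Elementary symmetric functions over the complex numbers\<close>

text \<open>Uniqueness of base \<open>M\<close> digits: \<open>mod M\<close> reads off the lowest
  digit and \<open>div M\<close> shifts the others down.\<close>

lemma sum_base_powers_inject:
  fixes d e :: "nat \<Rightarrow> nat"
  assumes "(\<Sum>i<n. d i * M ^ i) = (\<Sum>i<n. e i * M ^ i)"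
    and "\<And>i. i < n \<Longrightarrow> d i < M" "\<And>i. i < n \<Longrightarrow> e i < M" "i < n"
  shows "d i = e i"
  using assms
proof (induction n arbitrary: d e i)
  case (Suc n)
  have shift: "(\<Sum>i<Suc n. c i * M ^ i) = c 0 + M * (\<Sum>i<n. c (Suc i) * M ^ i)" for c :: "nat \<Rightarrow> nat"
    by (simp add: sum.lessThan_Suc_shift sum_distrib_left algebra_simps del: sum.lessThan_Suc)
  have eq: "d 0 + M * (\<Sum>i<n. d (Suc i) * M ^ i) = e 0 + M * (\<Sum>i<n. e (Suc i) * M ^ i)"
    using Suc.prems(1) by (simp only: shift)
  have bound: "d 0 < M" "e 0 < M"
    using Suc.prems(2)[of 0] Suc.prems(3)[of 0] by simp_all
  have "d 0 = e 0"
    using arg_cong[OF eq, of "\<lambda>k. k mod M"] bound by simp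
  moreover have "(\<Sum>i<n. d (Suc i) * M ^ i) = (\<Sum>i<n. e (Suc i) * M ^ i)"
    using arg_cong[OF eq, of "\<lambda>k. k div M"] bound by simp
  then have "d (Suc j) = e (Suc j)" if "j < n" for j
    using Suc.IH[of "\<lambda>i. d (Suc i)" "\<lambda>i. e (Suc i)" j] Suc.prems(2,3) that by simp
  ultimately show ?case
    using Suc.prems(4) by (cases i) auto
qed simp

text \<open>Kronecker substitution: for large \<open>M\<close>, putting \<open>t ^ M ^ i\<close> for the \<open>i\<close>-th variable keeps
  distinct monomials distinct.\<close>

lemma int_mpoly_ex_nonroot:
  fixes p :: "'v int_mpoly"
  assumes "p \<noteq> 0" "finite V"
  shows "\<exists>s :: 'v \<Rightarrow> complex. inj_on s V \<and> mpoly_eval s p \<noteq> 0"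
proof -
  \<comment> \<open>\<open>V\<close> may miss variables of \<open>p\<close>, and all of them must
    receive a value.\<close>
  define W where "W = V \<union> mpoly_vars p"
  have finW: "finite W"
    using assms by (simp add: W_def finite_mpoly_vars)
  then obtain idx :: "'v \<Rightarrow> nat" and n where idx: "idx ` W = {i. i < n}" "inj_on idx W"
    using finite_imp_inj_to_nat_seg by blast
  have "finite ((\<lambda>(m, v). Poly_Mapping.lookup m v) ` (Poly_Mapping.keys p \<times> W))"
    using finW by simp
  then obtain M0 where M0: "\<And>m v. m \<in> Poly_Mapping.keys p \<Longrightarrow> v \<in> W \<Longrightarrow> Poly_Mapping.lookup m v < M0"
    unfolding finite_nat_set_iff_bounded by force
  \<comment> \<open>\<open>M0\<close> exceeds all exponents, so they are base \<open>M\<close>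
    digits; the summand 2 ensures \<open>M \<ge> 2\<close>, so that the exponents
    \<open>M ^ idx v\<close> differ from each other.\<close>
  define M where "M = M0 + 2"
  have M: "Poly_Mapping.lookup m v < M" if "m \<in> Poly_Mapping.keys p" "v \<in> W" for m v
    using M0[OF that] by (simp add: M_def)
  define w where "w m = (\<Sum>v\<in>W. Poly_Mapping.lookup m v * M ^ idx v)" for m
  define g where "g = inv_into W idx"
  have bij: "bij_betw g {..<n} W"
    using bij_betw_inv_into[of idx W "{i. i < n}"] idx by (simp add: g_def bij_betw_def lessThan_def)
  have idx_g: "idx (g i) = i" if "i < n" for i
    unfolding g_def using that idx(1) by (intro f_inv_into_f) auto
  have w_g: "w m = (\<Sum>i<n. Poly_Mapping.lookup m (g i) * M ^ i)" for m
    unfolding w_def by (subst sum.reindex_bij_betw[OF bij, symmetric]) (simp add: idx_g)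
  have w_inj: "inj_on w (Poly_Mapping.keys p)"
  proof (rule inj_onI, rule poly_mapping_eqI)
    fix m m' v
    assume mm: "m \<in> Poly_Mapping.keys p" "m' \<in> Poly_Mapping.keys p" "w m = w m'"
    show "Poly_Mapping.lookup m v = Poly_Mapping.lookup m' v"
    proof (cases "v \<in> W")
      case True
      then obtain i where i: "i < n" "v = g i"
        using bij by (auto simp: bij_betw_def)
      have "Poly_Mapping.lookup m (g i) = Poly_Mapping.lookup m' (g i)"
        using mm bij i
        by (intro sum_base_powers_inject[where d = "\<lambda>i. Poly_Mapping.lookup m (g i)"
              and e = "\<lambda>i. Poly_Mapping.lookup m' (g i)" and M = M and n = n])
          (auto simp: w_g bij_betw_def intro!: M)
      then show ?thesis
        by (simp add: i)
    next
      case False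
      then have "v \<notin> Poly_Mapping.keys m" "v \<notin> Poly_Mapping.keys m'"
        using mm by (auto simp: W_def mpoly_vars_def)
      then show ?thesis
        by (simp add: in_keys_iff)
    qed
  qed
  \<comment> \<open>This is \<open>p\<close> after the substitution, as a polynomial in
    \<open>t\<close>. As \<open>w\<close> is injective on the monomials of \<open>p\<close>, no two
    terms merge and no coefficient cancels.\<close>
  define r :: "complex poly" where
    "r = (\<Sum>m\<in>Poly_Mapping.keys p. Polynomial.monom (of_int (Poly_Mapping.lookup p m)) (w m))"
  obtain m0 where m0: "m0 \<in> Poly_Mapping.keys p"
    using assms(1) by (metis all_not_in_conv keys_eq_empty)
  have "coeff r (w m0) = (\<Sum>m\<in>Poly_Mapping.keys p. if m = m0 then of_int (Poly_Mapping.lookup p m) else 0)"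
    unfolding r_def coeff_sum
    by (intro sum.cong refl) (use w_inj m0 in \<open>auto simp: inj_on_def\<close>)
  also have "\<dots> \<noteq> 0"
    using m0 by (simp add: in_keys_iff)
  finally have "r \<noteq> 0"
    by auto
  then have "finite {t. poly r t = 0}"
    by (rule poly_roots_finite)
  moreover have "infinite (of_nat ` {2..} :: complex set)"
    by (subst finite_image_iff) (auto simp: inj_on_def infinite_Ici)
  ultimately have "\<not> (of_nat ` {2..} \<subseteq> {t. poly r t = 0})"
    using finite_subset by blast
  \<comment> \<open>A natural number from 2 on has pairwise distinct powers, which makes the values
    of the variables distinct.\<close>
  then obtain k :: nat where k: "k \<ge> 2" "poly r (of_nat k) \<noteq> 0"
    by auto
  define s :: "'v \<Rightarrow> complex" where "s v = of_nat k ^ (M ^ idx v)" for v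
  have "inj_on s W"
  proof (rule inj_onI)
    fix u v assume uv: "u \<in> W" "v \<in> W" "s u = s v"
    then have "of_nat (k ^ (M ^ idx u)) = (of_nat (k ^ (M ^ idx v)) :: complex)"
      by (simp add: s_def)
    then have "k ^ (M ^ idx u) = k ^ (M ^ idx v)"
      by (simp only: of_nat_eq_iff)
    then have "idx u = idx v"
      using k(1) by (simp add: M_def)
    then show "u = v"
      using uv idx(2) by (simp add: inj_on_def)
  qed
  moreover have "mpoly_eval s p = poly r (of_nat k)"
  proof -
    have "monom_eval s m = of_nat k ^ w m" if "m \<in> Poly_Mapping.keys p" for m
    proof -
      have "monom_eval s m = (\<Prod>v\<in>W. s v ^ Poly_Mapping.lookup m v)"
        using that by (intro monom_eval_superset finW) (auto simp: W_def mpoly_vars_def)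
      also have "\<dots> = of_nat k ^ w m"
        by (simp add: s_def w_def power_sum power_mult [symmetric] mult.commute)
      finally show ?thesis .
    qed
    then show ?thesis
      by (simp add: mpoly_eval_superset[of "Poly_Mapping.keys p"] int_scale_of_int r_def poly_sum poly_monom)
  qed
  ultimately show ?thesis
    using k(2) inj_on_subset[of s W V] by (intro exI[of _ s]) (auto simp: W_def)
qed

text \<open>Points with coincidences on \<open>V\<close> may be ignored. This freedom matters for
  symmetric products, where the number of distinct roots is counted.\<close>

lemma int_mpoly_eqI:
  fixes p q :: "'v int_mpoly"
  assumes "finite V"
    and "\<And>s :: 'v \<Rightarrow> complex. inj_on s V \<Longrightarrow> mpoly_eval s p = mpoly_eval s q"
  shows "p = q"
  using int_mpoly_ex_nonroot[of "p - q" V] assms by (auto simp: mpoly_eval_diff)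

section \<open>Elementary symmetric functions as coefficients of products of linear factors\<close>

lemma elem_sym_0 [simp]: "finite I \<Longrightarrow> elem_sym 0 I x = 1"
proof -
  assume "finite I"
  then have "{S. S \<subseteq> I \<and> card S = 0} = {{}}"
    by (auto dest: finite_subset)
  then show ?thesis
    unfolding elem_sym_def by simp
qed

lemma elem_sym_Suc_empty [simp]: "elem_sym (Suc k) {} x = 0"
proof -
  have no: "{S. S \<subseteq> {} \<and> card S = Suc k} = {}"
    by auto
  show ?thesis
    unfolding elem_sym_def no by simp
qed

lemma elem_sym_Suc_insert:
  assumes "finite I" "a \<notin> I"
  shows "elem_sym (Suc k) (insert a I) x = elem_sym (Suc k) I x + x a * elem_sym k I x"
proof -
  let ?A = "\<lambda>k. {S. S \<subseteq> I \<and> card S = k}"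
  have fin: "finite (?A k)" for k
    using assms(1) by simp
  have split: "{S. S \<subseteq> insert a I \<and> card S = Suc k} = ?A (Suc k) \<union> insert a ` ?A k"
  proof (intro equalityI subsetI)
    fix S assume S: "S \<in> {S. S \<subseteq> insert a I \<and> card S = Suc k}"
    show "S \<in> ?A (Suc k) \<union> insert a ` ?A k"
    proof (cases "a \<in> S")
      case True
      then have "S = insert a (S - {a})" "S - {a} \<in> ?A k"
        using S by auto
      then show ?thesis
        by blast
    qed (use S in auto)
  next
    fix S assume "S \<in> ?A (Suc k) \<union> insert a ` ?A k"
    then show "S \<in> {S. S \<subseteq> insert a I \<and> card S = Suc k}"
      using assms by (auto simp: card_insert_if finite_subset)
  qed
  have inj: "inj_on (insert a) (?A k)"
    using assms(2) by (intro inj_onI) (metis (mono_tags, lifting) insert_ident mem_Collect_eq subsetD)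
  have "(\<Sum>S\<in>insert a ` ?A k. prod x S) = (\<Sum>S\<in>?A k. prod x (insert a S))"
    by (simp add: sum.reindex[OF inj])
  also have "\<dots> = x a * (\<Sum>S\<in>?A k. prod x S)"
    unfolding sum_distrib_left
    by (intro sum.cong refl prod.insert) (use assms in \<open>auto dest: finite_subset\<close>)
  finally have "(\<Sum>S\<in>insert a ` ?A k. prod x S) = x a * (\<Sum>S\<in>?A k. prod x S)" .
  moreover have "?A (Suc k) \<inter> insert a ` ?A k = {}"
    using assms(2) by auto
  ultimately show ?thesis
    unfolding elem_sym_def split by (simp add: sum.union_disjoint fin)
qed

lemma elem_sym_eq_0: "card I < k \<Longrightarrow> finite I \<Longrightarrow> elem_sym k I x = 0"
proof -
  assume "card I < k" "finite I"
  then have no: "{S. S \<subseteq> I \<and> card S = k} = {}"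
    by (auto dest: card_mono)
  show ?thesis
    unfolding elem_sym_def no by simp
qed

lemma fps_nth_prod_linear:
  fixes x :: "'i \<Rightarrow> 'a::comm_ring_1"
  assumes "finite I"
  shows "fps_nth (\<Prod>i\<in>I. 1 + fps_const (x i) * fps_X) k = elem_sym k I x"
  using assms
proof (induction I arbitrary: k)
  case empty
  then show ?case
    by (cases k) simp_all
next
  case (insert a I)
  then show ?case
    by (cases k) (simp_all add: elem_sym_Suc_insert distrib_right mult.assoc)
qed

text \<open>A root \<open>r\<close> is nonzero because the constant coefficient is 1, so
  \<open>[:-r, 1:]\<close> is \<open>- r\<close> times \<open>[:1, - 1 / r:]\<close>. Moving the
  scalar to the cofactor restores its constant coefficient 1. Once the degree is 0, the remaining
  factors are padded with \<open>x i = 0\<close>.\<close>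

lemma complex_poly_split:
  fixes q :: "complex poly"
  assumes "coeff q 0 = 1" "degree q \<le> n"
  shows "\<exists>x. q = (\<Prod>i\<in>{1..n}. [:1, x i:])"
  using assms
proof (induction n arbitrary: q)
  case 0
  then have "q = 1"
    using degree_0_id[of q] by (simp add: one_pCons)
  then show ?case
    by simp
next
  case (Suc n)
  show ?case
  proof (cases "degree q = 0")
    case True
    then have "q = 1"
      using degree_0_id[of q] Suc.prems(1) by (simp add: one_pCons)
    then have "q = (\<Prod>i\<in>{1..Suc n}. [:1, 0:])"
      by (simp add: one_pCons [symmetric])
    then show ?thesis
      by (intro exI[of _ "\<lambda>_. 0"])
  next
    case False
    then have "\<not> constant (poly q)"
      by (simp add: constant_degree)
    then obtain r where r: "poly q r = 0"
      using fundamental_theorem_of_algebra by blast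
    then have r0: "r \<noteq> 0"
      using Suc.prems(1) by (auto simp: poly_0_coeff_0)
    obtain q' where q': "q = [:-r, 1:] * q'"
      using r by (auto simp: poly_eq_0_iff_dvd)
    have "q \<noteq> 0"
      using Suc.prems(1) by auto
    then have "q' \<noteq> 0"
      using q' by auto
    then have "degree q' \<le> n"
      using Suc.prems(2) degree_mult_eq[of "[:-r, 1:]" q'] by (simp add: q')
    moreover have "coeff (smult (- r) q') 0 = 1"
      using Suc.prems(1) by (simp add: q')
    ultimately obtain x where x: "smult (- r) q' = (\<Prod>i\<in>{1..n}. [:1, x i:])"
      using Suc.IH[of "smult (- r) q'"] r0 by auto
    have "[:-r, 1:] = smult (- r) [:1, - 1 / r:]"
      using r0 by simp
    then have "q = [:1, - 1 / r:] * smult (- r) q'"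
      by (simp only: q' mult_smult_left mult_smult_right)
    also have "\<dots> = (\<Prod>i\<in>{1..Suc n}. [:1, (x(Suc n := - 1 / r)) i:])"
      unfolding x by (simp add: prod.nat_ivl_Suc' mult.commute)
    finally show ?thesis
      by blast
  qed
qed

text \<open>The prescribed values are made the coefficients of a polynomial, which is then factored.
  This serves both the uniqueness of \<open>ene_poly\<close> and the description of series by
  roots.\<close>

lemma ex_elem_sym_eq:
  fixes a :: "nat \<Rightarrow> complex"
  shows "\<exists>x. \<forall>k\<in>{1..n}. elem_sym k {1..n} x = a k"
proof -
  define q where "q = 1 + (\<Sum>k\<in>{1..n}. Polynomial.monom (a k) k)"
  have coeff_q: "coeff q k = (if k = 0 then 1 else if k \<le> n then a k else 0)" for k
    by (auto simp: q_def coeff_sum coeff_1 sum.delta')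
  have "coeff q 0 = 1" "degree q \<le> n"
    by (auto simp: coeff_q intro!: degree_le)
  then obtain x where x: "q = (\<Prod>i\<in>{1..n}. [:1, x i:])"
    using complex_poly_split by blast
  have "fps_of_poly q = (\<Prod>i\<in>{1..n}. 1 + fps_const (x i) * fps_X)"
    by (simp add: x fps_of_poly_prod fps_of_poly_pCons mult.commute)
  then have "coeff q k = elem_sym k {1..n} x" for k
    using fps_nth_prod_linear[of "{1..n}" x k] by (metis finite_atLeastAtMost fps_of_poly_nth)
  then have "\<forall>k\<in>{1..n}. elem_sym k {1..n} x = a k"
    using coeff_q by (metis atLeastAtMost_iff not_one_le_zero)
  then show ?thesis
    by blast
qed

section \<open>Existence and uniqueness of the polynomials defining the product\<close>

lemma unital_ring_hom_poly_map_poly: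
  fixes h :: "'a::comm_ring_1 \<Rightarrow> 'b::comm_ring_1"
  assumes "unital_ring_hom h"
  shows "unital_ring_hom (\<lambda>p. poly (map_poly h p) c)"
proof -
  interpret unital_ring_hom h
    by (rule assms)
  have 1: "map_poly h (p + q) = map_poly h p + map_poly h q" for p q
    by (rule poly_eqI) (simp add: coeff_map_poly zero add)
  have 2: "map_poly h (p * q) = map_poly h p * map_poly h q" for p q
    by (rule poly_eqI) (simp add: coeff_map_poly zero coeff_mult sum mult)
  have 3: "map_poly h 1 = 1"
    by (rule poly_eqI) (simp add: coeff_map_poly zero one coeff_1)
  show ?thesis
    by unfold_locales (simp_all add: 1 2 3)
qed

text \<open>Pseudo-division multiplies \<open>f\<close> by a power of the leading coefficient, which
  the same power of its inverse \<open>c\<close> undoes.\<close>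

lemma division_by_unit_lead_coeff:
  fixes f g :: "'a::comm_ring_1 poly"
  assumes "degree g = Suc N" "lead_coeff g * c = 1"
  shows "\<exists>q r. f = g * q + r \<and> degree r \<le> N"
proof -
  obtain q r where qr: "pseudo_divmod f g = (q, r)"
    by fastforce
  define m where "m = Suc (degree f) - degree g"
  have "g \<noteq> 0"
    using assms(1) by auto
  then have 1: "smult (lead_coeff g ^ m) f = g * q + r" and 2: "r = 0 \<or> degree r < degree g"
    using pseudo_divmod[OF _ qr] by (simp_all add: m_def)
  have "f = smult ((lead_coeff g * c) ^ m) f"
    by (simp add: assms(2))
  also have "\<dots> = smult (c ^ m) (smult (lead_coeff g ^ m) f)"
    by (simp add: power_mult_distrib mult.commute)
  also have "\<dots> = g * smult (c ^ m) q + smult (c ^ m) r"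
    by (simp add: 1 smult_add_right)
  finally have "f = g * smult (c ^ m) q + smult (c ^ m) r" .
  moreover have "degree (smult (c ^ m) r) \<le> N"
    using 2 assms(1) degree_smult_le[of "c ^ m" r] by auto
  ultimately show ?thesis
    by blast
qed

text \<open>The variables \<open>Inl k\<close> stand for the elementary symmetric functions of a finite family and
  \<open>[:0, 1:]\<close> for a member \<open>x\<^sub>j\<close> of it; \<open>removed_elem_sym k\<close> is then the \<open>k\<close>-th elementary symmetric
  function of the other members, read off from \<open>e\<^sub>k\<^sub>+\<^sub>1(I) = e\<^sub>k\<^sub>+\<^sub>1(I - {j}) + x\<^sub>j e\<^sub>k(I - {j})\<close>.\<close>

primrec removed_elem_sym :: "nat \<Rightarrow> (nat + nat) int_mpoly poly" where
  "removed_elem_sym 0 = 1"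
| "removed_elem_sym (Suc k) = [:mpoly_var (Inl (Suc k)):] - [:0, 1:] * removed_elem_sym k"

lemma degree_removed_elem_sym_le: "degree (removed_elem_sym k) \<le> k"
proof (induction k)
  case (Suc k)
  have "degree ([:0, 1:] * removed_elem_sym k) \<le> Suc k"
    using degree_mult_le[of "[:0, 1:]" "removed_elem_sym k"] Suc.IH by simp
  then show ?case
    unfolding removed_elem_sym.simps by (intro degree_diff_le) simp_all
qed simp

text \<open>The leading coefficient is a unit over the integers, which is what makes division by
  \<open>removed_elem_sym k\<close> possible.\<close>

lemma coeff_removed_elem_sym: "coeff (removed_elem_sym k) k = (- 1) ^ k"
  by (induction k) simp_all

lemma degree_removed_elem_sym: "degree (removed_elem_sym k) = k"
proof (rule antisym)
  have "coeff (removed_elem_sym k) k \<noteq> 0"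
    by (cases "even k") (simp_all add: coeff_removed_elem_sym)
  then show "k \<le> degree (removed_elem_sym k)"
    by (rule le_degree)
qed (rule degree_removed_elem_sym_le)

text \<open>For \<open>k = card I\<close> the right-hand side vanishes. Hence
  \<open>removed_elem_sym (card I)\<close> specializes to a polynomial with every \<open>x j\<close>
  as a root, namely the product of the \<open>x i - t\<close> in the variable
  \<open>t\<close>.\<close>

lemma poly_map_removed_elem_sym:
  fixes x :: "nat \<Rightarrow> complex"
  assumes "finite I" "j \<in> I"
  shows "poly (map_poly (mpoly_eval (case_sum (\<lambda>k. elem_sym k I x) b)) (removed_elem_sym k)) (x j)
    = elem_sym k (I - {j}) x"
proof -
  let ?s = "case_sum (\<lambda>k. elem_sym k I x) b"
  interpret ev: unital_ring_hom "\<lambda>p. poly (map_poly (mpoly_eval ?s) p) (x j)"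
    by (intro unital_ring_hom_poly_map_poly unital_ring_hom_mpoly_eval)
  show ?thesis
  proof (induction k)
    case 0
    then show ?case
      using assms by (simp add: ev.one)
  next
    case (Suc k)
    have "elem_sym (Suc k) I x = elem_sym (Suc k) (I - {j}) x + x j * elem_sym k (I - {j}) x"
      using elem_sym_Suc_insert[of "I - {j}" j k x] assms by (simp add: insert_absorb)
    then show ?case
      unfolding removed_elem_sym.simps ev.diff ev.mult Suc.IH
      by (simp add: map_poly_pCons mpoly_eval_0 mpoly_eval_1)
  qed
qed

text \<open>The induction step splits off one factor \<open>g(x\<^sub>j T)\<close>. Reducing modulo the monic polynomial with
  roots \<open>x\<^sub>i\<close> gives an expression for the whole product of degree less than \<open>card I\<close> in \<open>x\<^sub>j\<close>; as it
  takes the same value for every \<open>j \<in> I\<close>, it is constant in \<open>x\<^sub>j\<close>.\<close>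

lemma ex_symmetric_product_poly:
  "\<exists>P :: nat \<Rightarrow> (nat + nat) int_mpoly. \<forall>I (x :: nat \<Rightarrow> complex) b n.
     finite I \<and> card I = N \<and> inj_on x I \<longrightarrow>
     fps_nth (\<Prod>i\<in>I. Abs_fps (\<lambda>k. b k * x i ^ k)) n =
     mpoly_eval (case_sum (\<lambda>k. elem_sym k I x) b) (P n)"
proof (induction N)
  case 0
  show ?case
    by (rule exI[of _ "\<lambda>n. if n = 0 then 1 else 0"]) (auto simp: mpoly_eval_0 mpoly_eval_1)
next
  case (Suc N)
  then obtain P :: "nat \<Rightarrow> (nat + nat) int_mpoly" where P: "\<And>I (x :: nat \<Rightarrow> complex) b n.
      finite I \<Longrightarrow> card I = N \<Longrightarrow> inj_on x I \<Longrightarrow>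
      fps_nth (\<Prod>i\<in>I. Abs_fps (\<lambda>k. b k * x i ^ k)) n =
      mpoly_eval (case_sum (\<lambda>k. elem_sym k I x) b) (P n)"
    by blast
  \<comment> \<open>The Cauchy product of the split-off factor with the induction hypothesis for the
    remaining members, where the polynomial variable stands for the split-off member.\<close>
  define R :: "nat \<Rightarrow> (nat + nat) int_mpoly poly" where
    "R n = (\<Sum>k=0..n. [:mpoly_var (Inr k):] * [:0, 1:] ^ k *
       mpoly_eval (case_sum removed_elem_sym (\<lambda>k. [:mpoly_var (Inr k):])) (P (n - k)))" for n
  let ?\<chi> = "removed_elem_sym (Suc N)"
  have "\<exists>q r. R n = ?\<chi> * q + r \<and> degree r \<le> N" for n
    by (rule division_by_unit_lead_coeff[where c = "(- 1) ^ Suc N"])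
      (simp_all only: degree_removed_elem_sym coeff_removed_elem_sym power_mult_distrib[symmetric],
        simp)
  then obtain q r where qr: "\<And>n. R n = ?\<chi> * q n + r n" "\<And>n. degree (r n) \<le> N"
    by metis
  have "fps_nth (\<Prod>i\<in>I. Abs_fps (\<lambda>k. b k * x i ^ k)) n =
      mpoly_eval (case_sum (\<lambda>k. elem_sym k I x) b) (coeff (r n) 0)"
    if I: "finite I" "card I = Suc N" "inj_on x I" for I and x :: "nat \<Rightarrow> complex" and b n
  proof -
    let ?s = "case_sum (\<lambda>k. elem_sym k I x) b"
    define c where "c = fps_nth (\<Prod>i\<in>I. Abs_fps (\<lambda>k. b k * x i ^ k)) n"
    \<comment> \<open>The true coefficient \<open>c\<close> does not involve a chosen
      \<open>j\<close>, so \<open>\<rho>\<close> is a single polynomial that can be tested at all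
      members of the family.\<close>
    define \<rho> where "\<rho> = map_poly (mpoly_eval ?s) (r n) - [:c:]"
    have root: "poly \<rho> (x j) = 0" if j: "j \<in> I" for j
    proof -
      interpret ev: unital_ring_hom "\<lambda>p. poly (map_poly (mpoly_eval ?s) p) (x j)"
        by (intro unital_ring_hom_poly_map_poly unital_ring_hom_mpoly_eval)
      have card: "card (I - {j}) = N"
        using I j by simp
      have \<sigma>: "poly (map_poly (mpoly_eval ?s) (case_sum removed_elem_sym (\<lambda>k. [:mpoly_var (Inr k):]) v)) (x j)
          = case_sum (\<lambda>k. elem_sym k (I - {j}) x) b v" for v
        using I(1) j
        by (cases v) (simp_all add: poly_map_removed_elem_sym map_poly_pCons mpoly_eval_0)
      have "poly (map_poly (mpoly_eval ?s) (r n)) (x j)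
          = poly (map_poly (mpoly_eval ?s) (R n)) (x j)"
        unfolding qr(1) ev.add ev.mult poly_map_removed_elem_sym[OF I(1) j]
        using card I(1) by (simp add: elem_sym_eq_0)
      also have "\<dots> = (\<Sum>k=0..n. (b k * x j ^ k) *
          mpoly_eval (case_sum (\<lambda>k. elem_sym k (I - {j}) x) b) (P (n - k)))"
        unfolding R_def ev.sum ev.mult ev.power ev.mpoly_eval \<sigma>
        by (simp add: map_poly_pCons mpoly_eval_0 mpoly_eval_1)
      also have "\<dots> = (\<Sum>k=0..n. (b k * x j ^ k) *
          fps_nth (\<Prod>i\<in>I - {j}. Abs_fps (\<lambda>k. b k * x i ^ k)) (n - k))"
        using I card by (subst P) (auto intro: inj_on_subset)
      also have "\<dots> = c"
        unfolding c_def prod.remove[OF I(1) j] by (simp add: fps_mult_nth)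
      finally show ?thesis
        by (simp add: \<rho>_def)
    qed
    have "\<rho> = 0"
    proof (rule ccontr)
      assume "\<rho> \<noteq> 0"
      \<comment> \<open>Here injectivity of \<open>x\<close> enters: the members give
        \<open>N + 1\<close> different roots, one more than the degree of the remainder
        allows.\<close>
      have "Suc N = card (x ` I)"
        using I by (simp add: card_image)
      also have "\<dots> \<le> card {z. poly \<rho> z = 0}"
        using root \<open>\<rho> \<noteq> 0\<close> by (intro card_mono poly_roots_finite) auto
      also have "\<dots> \<le> degree \<rho>"
        by (rule card_poly_roots_bound) fact
      also have "\<dots> \<le> N"
        unfolding \<rho>_def using qr(2)[of n]
        by (intro degree_diff_le degree_le) (auto simp: coeff_map_poly mpoly_eval_0 coeff_eq_0)
      finally show False
        by simp
    qed
    then have "coeff (map_poly (mpoly_eval ?s) (r n)) 0 = c"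
      by (simp add: \<rho>_def)
    then show ?thesis
      by (simp add: c_def coeff_map_poly mpoly_eval_0)
  qed
  then show ?case
    by (intro exI[of _ "\<lambda>n. coeff (r n) 0"]) blast
qed

text \<open>The elementary symmetric function of the products is the coefficient of order
  \<open>n\<close> in a product of series \<open>g(x_i T)\<close> with
  \<open>b k = elem_sym k {1..n} y\<close>, so the symmetric product polynomial \<open>P n\<close>
  applies.\<close>

lemma ex_ene_poly:
  assumes "n \<ge> 1"
  shows "\<exists>Q. mpoly_vars Q \<subseteq> Inl ` {1..n} \<union> Inr ` {1..n} \<and>
     elem_sym n ({1..n} \<times> {1..n}) (\<lambda>(i, j). mpoly_var (Inl i) * mpoly_var (Inr j)) =
     mpoly_eval
       (case_sum (\<lambda>k. elem_sym k {1..n} (\<lambda>i. mpoly_var (Inl i :: nat + nat)))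
                 (\<lambda>k. elem_sym k {1..n} (\<lambda>j. mpoly_var (Inr j :: nat + nat)))) Q"
proof -
  let ?V = "Inl ` {1..n} \<union> Inr ` {1..n} :: (nat + nat) set"
  obtain P :: "nat \<Rightarrow> (nat + nat) int_mpoly" where P: "\<And>I (x :: nat \<Rightarrow> complex) b m.
      finite I \<Longrightarrow> card I = n \<Longrightarrow> inj_on x I \<Longrightarrow>
      fps_nth (\<Prod>i\<in>I. Abs_fps (\<lambda>k. b k * x i ^ k)) m =
      mpoly_eval (case_sum (\<lambda>k. elem_sym k I x) b) (P m)"
    using ex_symmetric_product_poly[of n] by blast
  \<comment> \<open>\<open>P n\<close> may contain variables of index 0 or above \<open>n\<close>.
    The elementary symmetric functions of those orders are 1 and 0, so substituting these constants
    keeps the value and confines the variables to \<open>1..n\<close>.\<close>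
  define t :: "nat + nat \<Rightarrow> (nat + nat) int_mpoly" where
    "t = case_sum (\<lambda>k. if k = 0 then 1 else if k \<le> n then mpoly_var (Inl k) else 0)
                  (\<lambda>k. if k = 0 then 1 else if k \<le> n then mpoly_var (Inr k) else 0)"
  define Q where "Q = mpoly_eval t (P n)"
  have "mpoly_vars Q \<subseteq> ?V"
    unfolding Q_def by (rule mpoly_vars_mpoly_eval) (auto simp: t_def split: sum.split)
  moreover have "elem_sym n ({1..n} \<times> {1..n}) (\<lambda>(i, j). mpoly_var (Inl i) * mpoly_var (Inr j)) =
     mpoly_eval
       (case_sum (\<lambda>k. elem_sym k {1..n} (\<lambda>i. mpoly_var (Inl i :: nat + nat)))
                 (\<lambda>k. elem_sym k {1..n} (\<lambda>j. mpoly_var (Inr j :: nat + nat)))) Q"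
    (is "?L = mpoly_eval ?E Q")
  \<comment> \<open>Testing only points injective on \<open>?V\<close> gives distinct
    \<open>x i\<close>, as \<open>P\<close> demands.\<close>
  proof (rule int_mpoly_eqI[where V = ?V])
    fix s :: "nat + nat \<Rightarrow> complex"
    assume inj: "inj_on s ?V"
    define x y where "x = (\<lambda>i. s (Inl i))" and "y = (\<lambda>i. s (Inr i))"
    have x_inj: "inj_on x {1..n}"
      using inj by (auto simp: inj_on_def x_def)
    have factor: "Abs_fps (\<lambda>k. elem_sym k {1..n} y * x i ^ k)
        = (\<Prod>j\<in>{1..n}. 1 + fps_const (x i * y j) * fps_X)" for i
    proof (rule fps_ext)
      fix k
      have "elem_sym k {1..n} (\<lambda>j. x i * y j) = elem_sym k {1..n} y * x i ^ k"
        unfolding elem_sym_def sum_distrib_right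
        by (rule sum.cong) (auto simp: prod.distrib)
      then show "fps_nth (Abs_fps (\<lambda>k. elem_sym k {1..n} y * x i ^ k)) k
          = fps_nth (\<Prod>j\<in>{1..n}. 1 + fps_const (x i * y j) * fps_X) k"
        by (simp only: fps_nth_prod_linear finite_atLeastAtMost fps_nth_Abs_fps)
    qed
    let ?e = "case_sum (\<lambda>k. elem_sym k {1..n} x) (\<lambda>k. elem_sym k {1..n} y)"
    have "mpoly_eval s ?L = elem_sym n ({1..n} \<times> {1..n}) (\<lambda>(i, j). x i * y j)"
      by (simp add: mpoly_eval_elem_sym case_prod_unfold mpoly_eval_mult x_def y_def)
    also have "\<dots> = fps_nth (\<Prod>(i, j)\<in>{1..n} \<times> {1..n}. 1 + fps_const (x i * y j) * fps_X) n"
      using fps_nth_prod_linear[of "{1..n} \<times> {1..n}" "\<lambda>(i, j). x i * y j" n]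
      by (simp only: case_prod_unfold finite_cartesian_product finite_atLeastAtMost)
    also have "\<dots> = fps_nth (\<Prod>i\<in>{1..n}. Abs_fps (\<lambda>k. elem_sym k {1..n} y * x i ^ k)) n"
      by (simp only: factor prod.cartesian_product)
    also have "\<dots> = mpoly_eval ?e (P n)"
      using x_inj by (intro P) auto
    also have "\<dots> = mpoly_eval (\<lambda>v. mpoly_eval ?e (t v)) (P n)"
    proof -
      have "?e v = mpoly_eval ?e (t v)" for v
        by (cases v) (auto simp: t_def mpoly_eval_0 mpoly_eval_1 elem_sym_eq_0)
      then show ?thesis
        by (intro mpoly_eval_cong)
    qed
    also have "\<dots> = mpoly_eval ?e Q"
      by (simp add: Q_def mpoly_eval_mpoly_eval)
    also have "?e = (\<lambda>v. mpoly_eval s (?E v))"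
      by (rule ext) (simp add: mpoly_eval_elem_sym x_def y_def split: sum.split)
    also have "mpoly_eval \<dots> Q = mpoly_eval s (mpoly_eval ?E Q)"
      by (rule mpoly_eval_mpoly_eval [symmetric])
    finally show "mpoly_eval s ?L = mpoly_eval s (mpoly_eval ?E Q)" .
  qed simp
  ultimately show ?thesis
    by blast
qed

text \<open>Uniqueness holds because any complex values for the variables of index
  \<open>1..n\<close> are elementary symmetric functions of suitable families. Two solutions thus
  agree at every complex point.\<close>

lemma ene_poly:
  assumes "n \<ge> 1"
  shows "mpoly_vars (ene_poly n) \<subseteq> Inl ` {1..n} \<union> Inr ` {1..n}"
    and "elem_sym n ({1..n} \<times> {1..n}) (\<lambda>(i, j). mpoly_var (Inl i) * mpoly_var (Inr j)) =
     mpoly_eval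
       (case_sum (\<lambda>k. elem_sym k {1..n} (\<lambda>i. mpoly_var (Inl i :: nat + nat)))
                 (\<lambda>k. elem_sym k {1..n} (\<lambda>j. mpoly_var (Inr j :: nat + nat)))) (ene_poly n)"
proof -
  let ?V = "Inl ` {1..n} \<union> Inr ` {1..n} :: (nat + nat) set"
  let ?E = "case_sum (\<lambda>k. elem_sym k {1..n} (\<lambda>i. mpoly_var (Inl i :: nat + nat)))
                     (\<lambda>k. elem_sym k {1..n} (\<lambda>j. mpoly_var (Inr j :: nat + nat)))"
  let ?L = "elem_sym n ({1..n} \<times> {1..n})
    (\<lambda>(i, j). mpoly_var (Inl i) * mpoly_var (Inr j)) :: (nat + nat) int_mpoly"
  have "Q = Q'" if Q: "mpoly_vars Q \<subseteq> ?V" "mpoly_vars Q' \<subseteq> ?V" "mpoly_eval ?E Q = mpoly_eval ?E Q'"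
    for Q Q'
  proof (rule int_mpoly_eqI[where V = "{}"])
    fix s :: "nat + nat \<Rightarrow> complex"
    obtain x y where xy: "\<forall>k\<in>{1..n}. elem_sym k {1..n} x = s (Inl k)"
        "\<forall>k\<in>{1..n}. elem_sym k {1..n} y = s (Inr k)"
      using ex_elem_sym_eq[of n "\<lambda>k. s (Inl k)"] ex_elem_sym_eq[of n "\<lambda>k. s (Inr k)"] by blast
    have "mpoly_eval s p = mpoly_eval (case_sum x y) (mpoly_eval ?E p)" if "mpoly_vars p \<subseteq> ?V" for p
      unfolding mpoly_eval_mpoly_eval
      by (rule mpoly_eval_cong) (use that xy in \<open>auto simp: mpoly_eval_elem_sym\<close>)
    then show "mpoly_eval s Q = mpoly_eval s Q'"
      using Q by simp
  qed simp
  then have "\<exists>!Q. mpoly_vars Q \<subseteq> ?V \<and> ?L = mpoly_eval ?E Q"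
    using ex_ene_poly[OF assms] by (intro ex_ex1I) auto
  from theI'[OF this] show "mpoly_vars (ene_poly n) \<subseteq> ?V" "?L = mpoly_eval ?E (ene_poly n)"
    unfolding ene_poly_def by blast+
qed

section \<open>Logarithmic derivatives over the complex numbers\<close>

lemma ene_prod_nth_0 [simp]: "fps_nth (f \<star> g) 0 = 1"
  by (simp add: ene_prod_def)

text \<open>The variables of \<open>ene_poly n\<close> have indices in \<open>1..n\<close>, so roots
  that reproduce \<open>f\<close> and \<open>g\<close> up to order \<open>n\<close> suffice.\<close>

lemma ene_prod_nth_elem_sym:
  fixes f g :: "complex fps"
  assumes "n \<ge> 1"
    and "\<And>k. k \<in> {1..n} \<Longrightarrow> fps_nth f k = elem_sym k {1..n} x"
    and "\<And>k. k \<in> {1..n} \<Longrightarrow> fps_nth g k = elem_sym k {1..n} y"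
  shows "fps_nth (f \<star> g) n = (- 1) ^ n * elem_sym n ({1..n} \<times> {1..n}) (\<lambda>(i, j). x i * y j)"
proof -
  let ?E = "case_sum (\<lambda>k. elem_sym k {1..n} (\<lambda>i. mpoly_var (Inl i :: nat + nat)))
                     (\<lambda>k. elem_sym k {1..n} (\<lambda>j. mpoly_var (Inr j :: nat + nat)))"
  have "mpoly_eval (case_sum (fps_nth f) (fps_nth g)) (ene_poly n)
      = mpoly_eval (case_sum x y) (mpoly_eval ?E (ene_poly n))"
    unfolding mpoly_eval_mpoly_eval
    by (rule mpoly_eval_cong) (use ene_poly(1)[OF assms(1)] assms(2,3) in \<open>auto simp: mpoly_eval_elem_sym\<close>)
  also have "\<dots> = elem_sym n ({1..n} \<times> {1..n}) (\<lambda>(i, j). x i * y j)"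
    unfolding ene_poly(2)[OF assms(1), symmetric]
    by (simp add: mpoly_eval_elem_sym case_prod_unfold mpoly_eval_mult)
  finally show ?thesis
    using assms(1) by (simp add: ene_prod_def)
qed

text \<open>For \<open>f = \<Prod>(1 - x\<^sub>i X)\<close> the coefficients of \<open>ghost f\<close> are the power sums of the \<open>x\<^sub>i\<close>.\<close>

definition ghost :: "complex fps \<Rightarrow> complex fps" where
  "ghost f = - fps_X * fps_deriv f * inverse f"

lemma ghost_nth_0 [simp]: "fps_nth (ghost f) 0 = 0"
  by (simp add: ghost_def mult.assoc)

lemma ghost_times:
  assumes "fps_nth f 0 = 1"
  shows "ghost f * f = - fps_X * fps_deriv f"
  using assms by (simp add: ghost_def mult.assoc inverse_mult_eq_1)

text \<open>Cancelling \<open>f\<close> characterizes \<open>ghost f\<close> by a linear equation,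
  so later computations avoid \<open>inverse\<close>.\<close>

lemma ghost_eqI:
  assumes "fps_nth f 0 = 1" "d * f = - fps_X * fps_deriv f"
  shows "ghost f = d"
proof -
  have "f \<noteq> 0"
    using assms(1) by auto
  then show ?thesis
    using ghost_times[OF assms(1)] assms(2) by (metis mult_right_cancel)
qed

lemma ghost_mult:
  assumes "fps_nth f 0 = 1" "fps_nth g 0 = 1"
  shows "ghost (f * g) = ghost f + ghost g"
proof (rule ghost_eqI)
  have "(ghost f + ghost g) * (f * g) = (ghost f * f) * g + (ghost g * g) * f"
    by (simp add: algebra_simps)
  also have "\<dots> = - fps_X * fps_deriv (f * g)"
    unfolding ghost_times[OF assms(1)] ghost_times[OF assms(2)] by (simp add: algebra_simps)
  finally show "(ghost f + ghost g) * (f * g) = - fps_X * fps_deriv (f * g)" .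
qed (use assms in simp)

lemma ghost_prod:
  assumes "\<And>i. i \<in> I \<Longrightarrow> fps_nth (f i) 0 = 1"
  shows "ghost (prod f I) = (\<Sum>i\<in>I. ghost (f i))"
  using assms
proof (induction I rule: infinite_finite_induct)
  case (insert i I)
  have "fps_nth (prod f I) 0 = (\<Prod>i\<in>I. fps_nth (f i) 0)"
    by (induction I rule: infinite_finite_induct) simp_all
  then have "fps_nth (prod f I) 0 = 1"
    using insert.prems by simp
  then show ?case
    using insert by (simp add: ghost_mult)
qed (simp_all add: ghost_eqI)

lemma ghost_linear: "ghost (1 + fps_const c * fps_X) = Abs_fps (\<lambda>k. if k = 0 then 0 else (- c) ^ k)"
proof (rule ghost_eqI)
  let ?d = "Abs_fps (\<lambda>k. if k = 0 then 0 else (- c) ^ k)"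
  show "?d * (1 + fps_const c * fps_X) = - fps_X * fps_deriv (1 + fps_const c * fps_X)"
  proof (rule fps_ext)
    fix k
    show "fps_nth (?d * (1 + fps_const c * fps_X)) k
        = fps_nth (- fps_X * fps_deriv (1 + fps_const c * fps_X)) k"
      by (cases k; cases "k - 1") (simp_all add: distrib_left mult.assoc[symmetric])
  qed
qed simp

text \<open>Newton's identities: compare coefficients in
  \<open>ghost f * f = - fps_X * fps_deriv f\<close>.\<close>

lemma ghost_nth_recursion:
  assumes "fps_nth f 0 = 1"
  shows "of_nat n * fps_nth f n
    = - fps_nth (ghost f) n - (\<Sum>i=0..<n. fps_nth (ghost f) i * fps_nth f (n - i))"
proof -
  have "fps_nth (ghost f * f) n
      = (\<Sum>i=0..<n. fps_nth (ghost f) i * fps_nth f (n - i)) + fps_nth (ghost f) n"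
    using assms by (simp add: fps_mult_nth sum.last_plus atLeastLessThanSuc_atLeastAtMost[symmetric])
  moreover have "fps_nth (ghost f * f) n = - (of_nat n * fps_nth f n)"
    by (cases n) (simp_all add: ghost_times[OF assms])
  ultimately have "of_nat n * fps_nth f n
      = - ((\<Sum>i=0..<n. fps_nth (ghost f) i * fps_nth f (n - i)) + fps_nth (ghost f) n)"
    by (metis minus_minus)
  then show ?thesis
    by simp
qed

text \<open>Given the lower coefficients, Newton's identities let the next coefficients of
  \<open>f\<close> and \<open>ghost f\<close> determine each other, since a positive integer can be
  cancelled. The statement goes order by order because a series agrees with a finite product only up
  to a given order.\<close>

lemma ghost_eq_upto_iff:
  assumes "fps_nth f 0 = 1" "fps_nth g 0 = 1"
  shows "(\<forall>k\<le>n. fps_nth (ghost f) k = fps_nth (ghost g) k) \<longleftrightarrow> (\<forall>k\<le>n. fps_nth f k = fps_nth g k)"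
proof (induction n)
  case 0
  then show ?case
    using assms by simp
next
  case (Suc n)
  have "fps_nth (ghost f) (Suc n) = fps_nth (ghost g) (Suc n) \<longleftrightarrow> fps_nth f (Suc n) = fps_nth g (Suc n)"
    if eq: "\<forall>k\<le>n. fps_nth f k = fps_nth g k" "\<forall>k\<le>n. fps_nth (ghost f) k = fps_nth (ghost g) k"
  proof -
    have sums: "(\<Sum>i=0..<Suc n. fps_nth (ghost f) i * fps_nth f (Suc n - i))
        = (\<Sum>i=0..<Suc n. fps_nth (ghost g) i * fps_nth g (Suc n - i))"
    proof (rule sum.cong)
      fix i assume "i \<in> {0..<Suc n}"
      \<comment> \<open>For \<open>i = 0\<close> the coefficients of \<open>f\<close> and
        \<open>g\<close> of order \<open>Suc n\<close> appear, whose equality is still open, but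
        they are multiplied by the constant coefficient of \<open>ghost\<close>, which is 0.\<close>
      then show "fps_nth (ghost f) i * fps_nth f (Suc n - i) = fps_nth (ghost g) i * fps_nth g (Suc n - i)"
        using eq by (cases i) auto
    qed simp
    have "(of_nat (Suc n) :: complex) \<noteq> 0"
      by (simp del: of_nat_Suc)
    then have "fps_nth f (Suc n) = fps_nth g (Suc n) \<longleftrightarrow>
        of_nat (Suc n) * fps_nth f (Suc n) = of_nat (Suc n) * fps_nth g (Suc n)"
      by (simp only: mult_cancel_left) simp
    then show ?thesis
      by (simp only: ghost_nth_recursion[OF assms(1)] ghost_nth_recursion[OF assms(2)] sums) auto
  qed
  then show ?case
    using Suc.IH by (auto simp: le_Suc_eq)
qed

lemma ghost_inject:
  assumes "fps_nth f 0 = 1" "fps_nth g 0 = 1" "ghost f = ghost g"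
  shows "f = g"
  using ghost_eq_upto_iff[OF assms(1,2)] assms(3) by (metis fps_ext order_refl)

lemma ghost_nth_prod_linear:
  assumes "k \<ge> 1"
  shows "fps_nth (ghost (\<Prod>i\<in>I. 1 + fps_const (x i) * fps_X)) k = (\<Sum>i\<in>I. (- x i) ^ k)"
  using assms by (simp add: ghost_prod ghost_linear fps_sum_nth)

text \<open>With \<open>n\<close> roots chosen for each series, the definition of
  \<open>\<star>\<close> gives agreement with the product \<open>w\<close> only in order
  \<open>n\<close>. Agreement in lower orders comes from the induction hypothesis: there the
  \<open>ghost\<close> coefficients coincide, hence so do the coefficients themselves. Both together
  give the \<open>ghost\<close> coefficient of order \<open>n\<close>.\<close>

lemma ghost_ene_prod:
  assumes "fps_nth f 0 = 1" "fps_nth g 0 = 1"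
  shows "fps_nth (ghost (f \<star> g)) n = fps_nth (ghost f) n * fps_nth (ghost g) n"
proof (induction n rule: less_induct)
  case (less n)
  show ?case
  proof (cases "n = 0")
    case False
    obtain x y where x: "\<forall>k\<in>{1..n}. elem_sym k {1..n} x = fps_nth f k"
        and y: "\<forall>k\<in>{1..n}. elem_sym k {1..n} y = fps_nth g k"
      using ex_elem_sym_eq[of n "fps_nth f"] ex_elem_sym_eq[of n "fps_nth g"] by blast
    define u where "u = (\<Prod>i\<in>{1..n}. 1 + fps_const (x i) * fps_X)"
    define v where "v = (\<Prod>i\<in>{1..n}. 1 + fps_const (y i) * fps_X)"
    \<comment> \<open>The sign is that of the factors \<open>1 - x_i y_j X\<close>: the factors of
      \<open>u\<close> and \<open>v\<close> belong to \<open>- x_i\<close> and \<open>- y_j\<close>,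
      whose product is \<open>x_i y_j\<close>.\<close>
    define w where "w = (\<Prod>p\<in>{1..n} \<times> {1..n}. 1 + fps_const (- (x (fst p) * y (snd p))) * fps_X)"
    have u: "fps_nth u k = elem_sym k {1..n} x" and v: "fps_nth v k = elem_sym k {1..n} y"
      and w: "fps_nth w k = elem_sym k ({1..n} \<times> {1..n}) (\<lambda>p. - (x (fst p) * y (snd p)))" for k
      unfolding u_def v_def w_def by (rule fps_nth_prod_linear; simp)+
    have 0: "fps_nth u 0 = 1" "fps_nth v 0 = 1" "fps_nth w 0 = 1"
      by (simp_all add: u v w)
    have "\<forall>k\<le>n. fps_nth u k = fps_nth f k" "\<forall>k\<le>n. fps_nth v k = fps_nth g k"
      using x y assms 0 u v by (metis One_nat_def Suc_leI atLeastAtMost_iff bot_nat_0.not_eq_extremum)+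
    then have uf: "\<forall>k\<le>n. fps_nth (ghost u) k = fps_nth (ghost f) k"
      and vg: "\<forall>k\<le>n. fps_nth (ghost v) k = fps_nth (ghost g) k"
      using ghost_eq_upto_iff 0 assms by blast+
    \<comment> \<open>A product of power sums is the power sum of the pairwise products.\<close>
    have "fps_nth (ghost w) k = fps_nth (ghost u) k * fps_nth (ghost v) k" for k
      by (cases "k = 0")
        (simp_all add: u_def v_def w_def ghost_nth_prod_linear sum_product sum.cartesian_product
          case_prod_unfold power_mult_distrib[symmetric])
    then have ghost_w: "fps_nth (ghost w) k = fps_nth (ghost f) k * fps_nth (ghost g) k" if "k \<le> n" for k
      using uf vg that by simp
    have "\<forall>k\<le>n - 1. fps_nth (ghost (f \<star> g)) k = fps_nth (ghost w) k"
      using less.IH ghost_w False by simp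
    then have "\<forall>k\<le>n - 1. fps_nth (f \<star> g) k = fps_nth w k"
      using ghost_eq_upto_iff[of "f \<star> g" w] 0 by simp
    moreover have "fps_nth (f \<star> g) n = fps_nth w n"
    proof -
      have "elem_sym n J (\<lambda>p. - z p) = (- 1) ^ n * elem_sym n J z"
        for J and z :: "nat \<times> nat \<Rightarrow> complex"
        unfolding elem_sym_def sum_distrib_left
        by (rule sum.cong) (auto simp: prod_uminus)
      then show ?thesis
        using False x y by (subst ene_prod_nth_elem_sym[of n f x g y]) (auto simp: w case_prod_unfold)
    qed
    ultimately have "\<forall>k\<le>n. fps_nth (f \<star> g) k = fps_nth w k"
      by (metis Suc_pred' False bot_nat_0.not_eq_extremum le_Suc_eq)
    then have "fps_nth (ghost (f \<star> g)) n = fps_nth (ghost w) n"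
      using ghost_eq_upto_iff[of "f \<star> g" w n] 0 by simp
    then show ?thesis
      using ghost_w by simp
  qed simp
qed

lemma ghost_one_minus_X: "k \<ge> 1 \<Longrightarrow> fps_nth (ghost (1 - fps_X)) k = 1"
  using ghost_linear[of "-1"] by (simp add: fps_const_neg [symmetric] del: fps_const_neg)

section \<open>The laws over the complex numbers\<close>

lemma complex_ene_prod_distrib:
  fixes f g h :: "complex fps"
  assumes "fps_nth f 0 = 1" "fps_nth g 0 = 1" "fps_nth h 0 = 1"
  shows "(f * g) \<star> h = (f \<star> h) * (g \<star> h)"
  by (rule ghost_inject)
    (use assms in \<open>auto intro!: fps_ext simp: ghost_ene_prod ghost_mult distrib_right\<close>)

lemma complex_ene_prod_assoc:
  fixes f g h :: "complex fps"
  assumes "fps_nth f 0 = 1" "fps_nth g 0 = 1" "fps_nth h 0 = 1"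
  shows "(f \<star> g) \<star> h = f \<star> (g \<star> h)"
  by (rule ghost_inject) (use assms in \<open>auto intro!: fps_ext simp: ghost_ene_prod mult.assoc\<close>)

lemma complex_ene_prod_commute:
  fixes f g :: "complex fps"
  assumes "fps_nth f 0 = 1" "fps_nth g 0 = 1"
  shows "f \<star> g = g \<star> f"
  by (rule ghost_inject) (use assms in \<open>auto intro!: fps_ext simp: ghost_ene_prod mult.commute\<close>)

lemma complex_ene_prod_one:
  fixes f :: "complex fps"
  assumes "fps_nth f 0 = 1"
  shows "f \<star> (1 - fps_X) = f"
proof (rule ghost_inject)
  show "ghost (f \<star> (1 - fps_X)) = ghost f"
  proof (rule fps_ext)
    fix n
    show "fps_nth (ghost (f \<star> (1 - fps_X))) n = fps_nth (ghost f) n"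
      using assms by (cases "n = 0") (simp_all add: ghost_ene_prod ghost_one_minus_X)
  qed
qed (use assms in simp_all)

section \<open>Arbitrary coefficient rings\<close>

definition eval_fps ::
  "('v \<Rightarrow> 'a::{comm_ring, comm_monoid_mult}) \<Rightarrow> 'v int_mpoly fps \<Rightarrow> 'a fps" where
  "eval_fps s F = Abs_fps (\<lambda>n. mpoly_eval s (fps_nth F n))"

lemma eval_fps_nth [simp]: "fps_nth (eval_fps s F) n = mpoly_eval s (fps_nth F n)"
  by (simp add: eval_fps_def)

lemma eval_fps_mult: "eval_fps s (F * G) = eval_fps s F * eval_fps s G"
  by (rule fps_ext) (simp add: fps_mult_nth mpoly_eval_sum mpoly_eval_mult)

lemma eval_fps_1: "eval_fps s 1 = 1"
  by (rule fps_ext) (simp add: mpoly_eval_0 mpoly_eval_1)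

lemma eval_fps_one_minus_X: "eval_fps s (1 - fps_X) = 1 - fps_X"
  by (rule fps_ext) (simp add: fps_X_def mpoly_eval_diff mpoly_eval_0 mpoly_eval_1)

text \<open>The coefficients of \<open>\<star>\<close> are the same integer polynomials over every
  ring, and evaluation commutes with substitution.\<close>

lemma eval_fps_ene_prod: "eval_fps s (F \<star> G) = eval_fps s F \<star> eval_fps s G"
proof (rule fps_ext)
  fix n
  have "(\<lambda>v. mpoly_eval s (case_sum (fps_nth F) (fps_nth G) v))
      = case_sum (fps_nth (eval_fps s F)) (fps_nth (eval_fps s G))"
    by (auto split: sum.split)
  then show "fps_nth (eval_fps s (F \<star> G)) n = fps_nth (eval_fps s F \<star> eval_fps s G) n"
    by (simp add: ene_prod_def mpoly_eval_1 mpoly_eval_mult mpoly_eval_power mpoly_eval_uminus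
        mpoly_eval_mpoly_eval)
qed

lemma eval_fps_eqI:
  assumes "\<And>s :: 'v \<Rightarrow> complex. eval_fps s F = eval_fps s G"
  shows "F = G"
proof (rule fps_ext)
  fix n
  show "fps_nth F n = fps_nth G n"
  proof (rule int_mpoly_eqI[where V = "{}"])
    fix s :: "'v \<Rightarrow> complex"
    show "mpoly_eval s (fps_nth F n) = mpoly_eval s (fps_nth G n)"
      using assms[of s] by (metis eval_fps_nth)
  qed simp
qed

lemma int_mpoly_ene_prod_laws:
  fixes F G H :: "'v int_mpoly fps"
  assumes "fps_nth F 0 = 1" "fps_nth G 0 = 1" "fps_nth H 0 = 1"
  shows "(F * G) \<star> H = (F \<star> H) * (G \<star> H)" "(F \<star> G) \<star> H = F \<star> (G \<star> H)"
    "F \<star> G = G \<star> F" "F \<star> (1 - fps_X) = F"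
proof -
  have 0: "fps_nth (eval_fps s F) 0 = 1" "fps_nth (eval_fps s G) 0 = 1"
    "fps_nth (eval_fps s H) 0 = 1" for s :: "'v \<Rightarrow> complex"
    using assms by (simp_all add: mpoly_eval_1)
  note eval = eval_fps_mult eval_fps_ene_prod eval_fps_one_minus_X
  show "(F * G) \<star> H = (F \<star> H) * (G \<star> H)"
    by (rule eval_fps_eqI, unfold eval) (rule complex_ene_prod_distrib[OF 0])
  show "(F \<star> G) \<star> H = F \<star> (G \<star> H)"
    by (rule eval_fps_eqI, unfold eval) (rule complex_ene_prod_assoc[OF 0])
  show "F \<star> G = G \<star> F"
    by (rule eval_fps_eqI, unfold eval) (rule complex_ene_prod_commute[OF 0(1,2)])
  show "F \<star> (1 - fps_X) = F"
    by (rule eval_fps_eqI, unfold eval) (rule complex_ene_prod_one[OF 0(1)])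
qed

text \<open>\<open>F i\<close> is the generic series with one variable per coefficient, and
  \<open>s\<close> specializes it to \<open>f i\<close>. Its constant coefficient is the literal 1,
  so that the laws apply to \<open>F i\<close> itself before specialization.\<close>

lemma ex_eval_fps:
  fixes f :: "'i \<Rightarrow> 'a::{comm_ring, comm_monoid_mult} fps"
  assumes "\<And>i. f i \<in> one_plus_X_fps"
  shows "\<exists>(s :: 'i \<times> nat \<Rightarrow> 'a) F. \<forall>i. fps_nth (F i) 0 = 1 \<and> f i = eval_fps s (F i)"
proof (intro exI allI conjI)
  let ?s = "\<lambda>(i, n). fps_nth (f i) n"
  let ?F = "\<lambda>i. Abs_fps (\<lambda>n. if n = 0 then 1 else mpoly_var (i, n))"
  fix i :: 'i
  show "fps_nth (?F i) 0 = 1"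
    by simp
  show "f i = eval_fps ?s (?F i)"
    by (rule fps_ext) (use assms in \<open>auto simp: mpoly_eval_1 one_plus_X_fps_def\<close>)
qed

text \<open>A law mixes its series, so one point \<open>s\<close> has to specialize all three at
  once.\<close>

lemma ex_eval_fps3:
  fixes f g h :: "'a::{comm_ring, comm_monoid_mult} fps"
  assumes "f \<in> one_plus_X_fps" "g \<in> one_plus_X_fps" "h \<in> one_plus_X_fps"
  obtains s :: "nat \<times> nat \<Rightarrow> 'a" and F G H
  where "fps_nth F 0 = 1" "fps_nth G 0 = 1" "fps_nth H 0 = 1"
    "f = eval_fps s F" "g = eval_fps s G" "h = eval_fps s H"
proof -
  let ?f = "\<lambda>i::nat. if i = 0 then f else if i = 1 then g else h"
  have mem: "?f i \<in> one_plus_X_fps" for i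
    using assms by simp
  obtain s :: "nat \<times> nat \<Rightarrow> 'a" and F
    where F: "\<And>i. fps_nth (F i) 0 = 1" "\<And>i. ?f i = eval_fps s (F i)"
    using ex_eval_fps[of ?f, OF mem] by blast
  show thesis
    using that[of "F 0" "F 1" "F 2" s] F(1) F(2)[of 0] F(2)[of 1] F(2)[of 2] by simp
qed

section \<open>Transfer of the laws to the coefficient ring\<close>

lemma one_plus_X_fps_closed:
  "1 \<in> one_plus_X_fps" "1 - fps_X \<in> one_plus_X_fps" "f \<star> g \<in> one_plus_X_fps"
  "f \<in> one_plus_X_fps \<Longrightarrow> g \<in> one_plus_X_fps \<Longrightarrow> f * g \<in> one_plus_X_fps"
  by (simp_all add: one_plus_X_fps_def)

lemma
  fixes f g h :: "'a::{comm_ring, comm_monoid_mult} fps"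
  assumes "f \<in> one_plus_X_fps" "g \<in> one_plus_X_fps" "h \<in> one_plus_X_fps"
  shows ene_prod_distrib: "(f * g) \<star> h = (f \<star> h) * (g \<star> h)"
    and ene_prod_assoc: "(f \<star> g) \<star> h = f \<star> (g \<star> h)"
proof -
  obtain s :: "nat \<times> nat \<Rightarrow> 'a" and F G H where 0: "fps_nth F 0 = 1" "fps_nth G 0 = 1" "fps_nth H 0 = 1"
    and fgh: "f = eval_fps s F" "g = eval_fps s G" "h = eval_fps s H"
    using ex_eval_fps3[OF assms] .
  note eval = eval_fps_mult[symmetric] eval_fps_ene_prod[symmetric]
  show "(f * g) \<star> h = (f \<star> h) * (g \<star> h)"
    unfolding fgh eval int_mpoly_ene_prod_laws(1)[OF 0] ..
  show "(f \<star> g) \<star> h = f \<star> (g \<star> h)"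
    unfolding fgh eval int_mpoly_ene_prod_laws(2)[OF 0] ..
qed

lemma ene_prod_commute:
  fixes f g :: "'a::{comm_ring, comm_monoid_mult} fps"
  assumes "f \<in> one_plus_X_fps" "g \<in> one_plus_X_fps"
  shows "f \<star> g = g \<star> f"
proof -
  obtain s :: "nat \<times> nat \<Rightarrow> 'a" and F G H where 0: "fps_nth F 0 = 1" "fps_nth G 0 = 1" "fps_nth H 0 = 1"
    and fg: "f = eval_fps s F" "g = eval_fps s G" "f = eval_fps s H"
    using ex_eval_fps3[OF assms assms(1)] .
  show ?thesis
    unfolding fg(1,2) eval_fps_ene_prod[symmetric] int_mpoly_ene_prod_laws(3)[OF 0] ..
qed

lemma
  fixes f :: "'a::{comm_ring, comm_monoid_mult} fps"
  assumes "f \<in> one_plus_X_fps"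
  shows ene_prod_one: "f \<star> (1 - fps_X) = f"
    and one_plus_X_fps_one: "1 * f = f"
    and one_plus_X_fps_inverse: "\<exists>f'\<in>one_plus_X_fps. f' * f = 1"
proof -
  obtain s :: "nat \<times> nat \<Rightarrow> 'a" and F G H where 0: "fps_nth F 0 = 1" "fps_nth G 0 = 1" "fps_nth H 0 = 1"
    and f: "f = eval_fps s F" "f = eval_fps s G" "f = eval_fps s H"
    using ex_eval_fps3[OF assms assms assms] .
  show "f \<star> (1 - fps_X) = f"
    unfolding f(1) eval_fps_one_minus_X[of s, symmetric] eval_fps_ene_prod[symmetric]
      int_mpoly_ene_prod_laws(4)[OF 0] ..
  show "1 * f = f"
    unfolding f(1) eval_fps_1[of s, symmetric] eval_fps_mult[symmetric] by simp
  \<comment> \<open>The argument \<open>1\<close> is an inverse of the constant coefficient, so the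
    inverse of the generic series has integer polynomials as coefficients and can be evaluated at
    \<open>s\<close>.\<close>
  have "fps_left_inverse F 1 * F = 1"
    by (rule fps_left_inverse) (simp add: 0)
  then have "eval_fps s (fps_left_inverse F 1) * f = 1"
    by (simp add: f(1) eval_fps_mult[symmetric] eval_fps_1)
  moreover have "eval_fps s (fps_left_inverse F 1) \<in> one_plus_X_fps"
    by (simp add: one_plus_X_fps_def mpoly_eval_1)
  ultimately show "\<exists>f'\<in>one_plus_X_fps. f' * f = 1"
    by blast
qed

theorem theorem2p6:
  shows "cring (ene_ring :: 'a::{comm_ring, comm_monoid_mult} fps ring) \<and>
    comm_group \<lparr>carrier = one_plus_X_fps :: 'a fps set, monoid.mult = (*), one = 1\<rparr> \<and>
    (\<forall>f\<in>one_plus_X_fps :: 'a fps set. \<forall>g\<in>one_plus_X_fps. \<forall>h\<in>one_plus_X_fps. (f * g) \<star> h = (f \<star> h) * (g \<star> h)) \<and>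
    (\<forall>f\<in>one_plus_X_fps :: 'a fps set. \<forall>g\<in>one_plus_X_fps. \<forall>h\<in>one_plus_X_fps. (f \<star> g) \<star> h = f \<star> (g \<star> h)) \<and>
    (\<forall>f\<in>one_plus_X_fps :: 'a fps set. \<forall>g\<in>one_plus_X_fps. f \<star> g = g \<star> f) \<and>
    (\<forall>f\<in>one_plus_X_fps :: 'a fps set. f \<star> (1 - fps_X) = f \<and> (1 - fps_X) \<star> f = f)"
proof (intro conjI ballI)
  show "cring (ene_ring :: 'a fps ring)"
  proof (rule cringI)
    show "abelian_group (ene_ring :: 'a fps ring)"
      by (rule abelian_groupI)
        (auto simp: ene_ring_def one_plus_X_fps_closed one_plus_X_fps_one one_plus_X_fps_inverse
          mult.assoc intro: mult.commute)
    show "comm_monoid (ene_ring :: 'a fps ring)"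
    proof (rule comm_monoidI)
      fix f assume f: "f \<in> carrier (ene_ring :: 'a fps ring)"
      have "(1 - fps_X) \<star> f = f"
        using f ene_prod_commute[of "1 - fps_X" f] ene_prod_one[of f]
        by (simp add: ene_ring_def one_plus_X_fps_closed)
      then show "\<one>\<^bsub>ene_ring\<^esub> \<otimes>\<^bsub>ene_ring\<^esub> f = f"
        by (simp add: ene_ring_def)
    qed (auto simp: ene_ring_def one_plus_X_fps_closed intro: ene_prod_assoc ene_prod_commute)
  qed (auto simp: ene_ring_def intro: ene_prod_distrib)
  show "comm_group \<lparr>carrier = one_plus_X_fps :: 'a fps set, monoid.mult = (*), one = 1\<rparr>"
    by (rule comm_groupI)
      (auto simp: one_plus_X_fps_closed one_plus_X_fps_one one_plus_X_fps_inverse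
        mult.assoc intro: mult.commute)
next
  fix f :: "'a fps" assume f: "f \<in> one_plus_X_fps"
  show "f \<star> (1 - fps_X) = f"
    using f by (rule ene_prod_one)
  then show "(1 - fps_X) \<star> f = f"
    using f ene_prod_commute[of "1 - fps_X" f] by (simp add: one_plus_X_fps_closed)
qed (simp_all only: ene_prod_distrib ene_prod_assoc ene_prod_commute)

end
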